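(* Let $C$ be a finite nonempty set of categories, let $P(x\mid c)$ ($c\in C$) be the distribution of instances of category $c$, and fix a classifier which assigns to each instance $x$ an estimated category $\hat c(x)\in C$. Let $\alpha\in[0,1]$, $\epsilon_1,\epsilon_2\ge 0$, and let $N,M\ge 1$ be integers. Then the confidence of the $(\alpha,N,M,\epsilon_1,\epsilon_2)$-fraction-accurate estimator, i.e. the probability, over the random experiment, that its claimed lower bound $\hat q-\epsilon_2$ on the fraction of $\alpha$-accurate categories is correct (is at most the true fraction of $\alpha$-accurate categories), satisfies $$ \text{confidence}\;\ge\;\inf_{0<\theta<1}\left[\,1-c_{\,c_{\alpha,M}\left(\lceil(\alpha+\epsilon_1)M\rceil\right),\;N-\lfloor(\theta+\epsilon_2/2)N\rfloor}\left(\left\lceil\tfrac{\epsilon_2}{2}N\right\rceil\right)-c_{\theta,N}\left(\lceil(\theta+\epsilon_2/2)N\rceil\right)\right], $$ where $c_{p,n}(x)=\sum_{i=x}^{n}\binom{n}{i}p^i(1-p)^{n-i}$.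
   Context: Binomial tail: for $p\in[0,1]$ and integers $n,x$ with $x\ge 0$, $c_{p,n}(x)=\sum_{i=x}^{n}\binom{n}{i}p^{i}(1-p)^{n-i}$ is the probability that a coin with probability of heads $p$ comes up heads $x$ or more times in $n$ independent flips; the sum is empty (equal to $0$) when $x>n$. In the claim, the first tail has success probability $p=c_{\alpha,M}(\lceil(\alpha+\epsilon_1)M\rceil)$ and number of flips $n=N-\lfloor(\theta+\epsilon_2/2)N\rfloor$. True-positive accuracy: for a category $c\in C$, the true-positive accuracy of the classifier is $p_c=P(\hat c(x)=c\mid c)$, the probability that the classifier outputs $c$ on an instance $x$ drawn from $P(\cdot\mid c)$. A category $c$ is $\alpha$-accurate if $p_c\ge\alpha$; this is a fixed (non-random) property of the category and the classifier. The accurate fraction is the fraction of categories in $C$ that are $\alpha$-accurate. Fraction-accurate estimator with parameters $(\alpha,N,M,\epsilon_1,\epsilon_2)$: 1. Random experiment: draw $N$ categories $c_1,\dots,c_N$ independently and uniformly at random from $C$, with replacement; for each drawn $c_j$, draw $M$ instances independently from $P(\cdot\mid c_j)$ (all draws for different $j$ being independent given the drawn categories, even when the same category is drawn more than once). 2. For each $j$, let $\hat p_j$ be the empirical accuracy, i.e. the fraction of the $M$ instances drawn for $c_j$ on which the classifier outputs $c_j$. Declare the $j$-th drawn category classifiable if $\hat p_j\ge\alpha+\epsilon_1$. 3. Let $\hat q$ be the fraction of the $N$ drawn categories that are declared classifiable. The estimator claims that the accurate fraction is at least $\hat q-\epsilon_2$. The confidence of the estimator is the probability, over the random experiment, that this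 claim is correct, i.e. that (accurate fraction) $\ge\hat q-\epsilon_2$. *)

theory Defs
  imports "HOL-Probability.Probability"
begin

text \<open>
  The number of flips and the threshold are integers, so that the number of flips may become
  negative without truncation; the sum is then empty, as it is whenever \<open>x > n\<close>. Only
  thresholds \<open>x \<ge> 0\<close> are meaningful.
\<close>
definition binomial_tail :: "real \<Rightarrow> int \<Rightarrow> int \<Rightarrow> real" where
  "binomial_tail p n x =
     (\<Sum>i\<in>{x..n}. real (nat n choose nat i) * p ^ nat i * (1 - p) ^ nat (n - i))"

text \<open>
  Throughout, \<open>C\<close> is the set of categories, \<open>S\<close> the measurable space of instances (only its
  \<open>\<sigma>\<close>-algebra matters), \<open>P c\<close> the distribution on \<open>S\<close> of the instances of category \<open>c\<close>, and
  \<open>h\<close> the classifier.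
\<close>
definition true_positive_accuracy :: "('c \<Rightarrow> 'x measure) \<Rightarrow> ('x \<Rightarrow> 'c) \<Rightarrow> 'c \<Rightarrow> real" where
  "true_positive_accuracy P h c = \<P>(x in P c. h x = c)"

definition accurate :: "('c \<Rightarrow> 'x measure) \<Rightarrow> ('x \<Rightarrow> 'c) \<Rightarrow> real \<Rightarrow> 'c \<Rightarrow> bool" where
  "accurate P h \<alpha> c \<longleftrightarrow> true_positive_accuracy P h c \<ge> \<alpha>"

definition accurate_fraction ::
  "'c set \<Rightarrow> ('c \<Rightarrow> 'x measure) \<Rightarrow> ('x \<Rightarrow> 'c) \<Rightarrow> real \<Rightarrow> real" where
  "accurate_fraction C P h \<alpha> = real (card {c \<in> C. accurate P h \<alpha> c}) / real (card C)"

text \<open>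
  An outcome is a pair \<open>(c, X)\<close>, where \<open>c j\<close> is the \<open>j\<close>-th drawn category and \<open>X j i\<close> is the
  \<open>i\<close>-th instance drawn for it (\<open>j < N\<close>, \<open>i < M\<close>). Given \<open>c\<close>, all \<open>X j i\<close> are independent, also
  when \<open>c\<close> takes the same value at different positions.
\<close>
definition sampling_experiment ::
  "'c set \<Rightarrow> 'x measure \<Rightarrow> ('c \<Rightarrow> 'x measure) \<Rightarrow> nat \<Rightarrow> nat \<Rightarrow>
     ((nat \<Rightarrow> 'c) \<times> (nat \<Rightarrow> nat \<Rightarrow> 'x)) measure" where
  "sampling_experiment C S P N M = do {
     c \<leftarrow> (\<Pi>\<^sub>M j\<in>{..<N}. uniform_count_measure C);
     X \<leftarrow> (\<Pi>\<^sub>M j\<in>{..<N}. \<Pi>\<^sub>M i\<in>{..<M}. P (c j));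
     return ((\<Pi>\<^sub>M j\<in>{..<N}. uniform_count_measure C) \<Otimes>\<^sub>M (\<Pi>\<^sub>M j\<in>{..<N}. \<Pi>\<^sub>M i\<in>{..<M}. S)) (c, X)
   }"

definition empirical_accuracy :: "('x \<Rightarrow> 'c) \<Rightarrow> nat \<Rightarrow> 'c \<Rightarrow> (nat \<Rightarrow> 'x) \<Rightarrow> real" where
  "empirical_accuracy h M c x = real (card {i. i < M \<and> h (x i) = c}) / real M"

definition declared_fraction ::
  "('x \<Rightarrow> 'c) \<Rightarrow> real \<Rightarrow> nat \<Rightarrow> nat \<Rightarrow> real \<Rightarrow> (nat \<Rightarrow> 'c) \<Rightarrow> (nat \<Rightarrow> nat \<Rightarrow> 'x) \<Rightarrow> real" where
  "declared_fraction h \<alpha> N M \<epsilon>\<^sub>1 c X =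
     real (card {j. j < N \<and> empirical_accuracy h M (c j) (X j) \<ge> \<alpha> + \<epsilon>\<^sub>1}) / real N"

definition confidence ::
  "'c set \<Rightarrow> 'x measure \<Rightarrow> ('c \<Rightarrow> 'x measure) \<Rightarrow> ('x \<Rightarrow> 'c) \<Rightarrow>
     real \<Rightarrow> nat \<Rightarrow> nat \<Rightarrow> real \<Rightarrow> real \<Rightarrow> real" where
  "confidence C S P h \<alpha> N M \<epsilon>\<^sub>1 \<epsilon>\<^sub>2 =
     \<P>((c, X) in sampling_experiment C S P N M.
         accurate_fraction C P h \<alpha> \<ge> declared_fraction h \<alpha> N M \<epsilon>\<^sub>1 c X - \<epsilon>\<^sub>2)"

end

theory Submission
  imports Defs
begin

text \<open>
  Condition on the drawn categories and treat every drawn accurate category as declared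
  classifiable; every other one is declared with probability at most
  \<open>p = c\<^bsub>\<alpha>,M\<^esub>(\<lceil>(\<alpha> + \<epsilon>\<^sub>1) M\<rceil>)\<close>. Let \<open>q\<close> be the accurate fraction and
  \<open>m = \<lfloor>(q + \<epsilon>\<^sub>2/2) N\<rfloor>\<close>. Either more than \<open>m\<close> of the draws are accurate, which is bounded by the second
  tail at \<open>\<theta> = q\<close>; or at most \<open>m\<close> are, and then the probability of more than
  \<open>(q + \<epsilon>\<^sub>2) N\<close> declarations is largest when exactly \<open>m\<close> are, in which case more than
  \<open>(\<epsilon>\<^sub>2/2) N\<close> of the remaining \<open>N - m\<close> draws would have to be declared. If
  \<open>q + \<epsilon>\<^sub>2 \<ge> 1\<close>, the claim is always correct; this covers \<open>q = 1\<close>. The value \<open>q = 0\<close>, also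
  outside the range of the infimum, is replaced by a small \<open>\<theta> > 0\<close>.
\<close>

subsection \<open>Binomial and Poisson binomial tails\<close>

text \<open>The upper tail of the Poisson binomial distribution, for independent trials with success
  probabilities \<open>r i\<close>. The sum runs over the exact set \<open>J\<close> of successes
  rather than over counts, which suits both recursion on \<open>I\<close> and the decomposition of
  events in a product space.\<close>

definition poisson_binomial_tail :: "'i set \<Rightarrow> ('i \<Rightarrow> real) \<Rightarrow> nat \<Rightarrow> real" where
  "poisson_binomial_tail I r k =
     (\<Sum>J\<in>{J\<in>Pow I. k \<le> card J}. (\<Prod>j\<in>J. r j) * (\<Prod>j\<in>I - J. 1 - r j))"

lemma poisson_binomial_tail_cong:
  "(\<And>i. i \<in> I \<Longrightarrow> r i = s i) \<Longrightarrow> poisson_binomial_tail I r k = poisson_binomial_tail I s k"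
  unfolding poisson_binomial_tail_def
  by (intro sum.cong arg_cong2[where f = "(*)"] prod.cong) auto

lemma poisson_binomial_tail_empty:
  "poisson_binomial_tail {} r k = (if k = 0 then 1 else 0)"
proof -
  have "{J \<in> Pow {}. k \<le> card J} = (if k = 0 then {{}} else {})"
    by auto
  then show ?thesis
    by (simp add: poisson_binomial_tail_def)
qed

text \<open>Condition on trial \<open>i\<close>: the success sets split into those that contain
  \<open>i\<close> and those that do not. At \<open>k = 0\<close> the truncated \<open>k - 1\<close>
  is again 0, which is correct, since the threshold is then void in both cases.\<close>

lemma poisson_binomial_tail_insert:
  assumes "finite I" "i \<notin> I"
  shows "poisson_binomial_tail (insert i I) r k =
    r i * poisson_binomial_tail I r (k - 1) + (1 - r i) * poisson_binomial_tail I r k"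
proof -
  define f where "f A J = (\<Prod>j\<in>J. r j) * (\<Prod>j\<in>A - J. 1 - r j)" for A J
  have fin: "finite J" if "J \<in> Pow I" for J
    using that assms finite_subset by auto
  have *: "{J \<in> Pow (insert i I). k \<le> card J} =
      insert i ` {J \<in> Pow I. k - 1 \<le> card J} \<union> {J \<in> Pow I. k \<le> card J}" (is "?L = ?R1 \<union> ?R2")
  proof -
    have "k \<le> card (insert i J) \<longleftrightarrow> k - 1 \<le> card J" if "J \<in> Pow I" for J
      using that fin[OF that] assms by (subst card_insert_disjoint) auto
    then show ?thesis
      unfolding Pow_insert by auto
  qed
  have "poisson_binomial_tail (insert i I) r k = sum (f (insert i I)) ?L"
    by (simp add: poisson_binomial_tail_def f_def)
  also have "\<dots> = sum (f (insert i I)) ?R1 + sum (f (insert i I)) ?R2"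
    unfolding * using assms by (intro sum.union_disjoint) auto
  also have "sum (f (insert i I)) ?R1 = (\<Sum>J\<in>{J \<in> Pow I. k - 1 \<le> card J}. f (insert i I) (insert i J))"
    using assms by (subst sum.reindex) (auto simp: inj_on_def)
  also have "\<dots> = (\<Sum>J\<in>{J \<in> Pow I. k - 1 \<le> card J}. r i * f I J)"
  proof (intro sum.cong refl)
    fix J assume J: "J \<in> {J \<in> Pow I. k - 1 \<le> card J}"
    then have "i \<notin> J" "insert i I - insert i J = I - J"
      using assms by auto
    then show "f (insert i I) (insert i J) = r i * f I J"
      using J fin[of J] by (simp add: f_def)
  qed
  also have "\<dots> = r i * poisson_binomial_tail I r (k - 1)"
    by (simp add: poisson_binomial_tail_def f_def sum_distrib_left)
  also have "sum (f (insert i I)) ?R2 = (\<Sum>J\<in>{J \<in> Pow I. k \<le> card J}. (1 - r i) * f I J)"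
  proof (intro sum.cong refl)
    fix J assume J: "J \<in> {J \<in> Pow I. k \<le> card J}"
    then have "insert i I - J = insert i (I - J)"
      using assms by auto
    then show "f (insert i I) J = (1 - r i) * f I J"
      using assms by (simp add: f_def)
  qed
  also have "\<dots> = (1 - r i) * poisson_binomial_tail I r k"
    by (simp add: poisson_binomial_tail_def f_def sum_distrib_left)
  finally show ?thesis .
qed

lemma poisson_binomial_tail_0: "finite I \<Longrightarrow> poisson_binomial_tail I r 0 = 1"
  by (induction rule: finite_induct)
     (simp_all add: poisson_binomial_tail_empty poisson_binomial_tail_insert)

lemma poisson_binomial_tail_nonneg:
  assumes "\<And>i. i \<in> I \<Longrightarrow> r i \<in> {0..1}"
  shows "0 \<le> poisson_binomial_tail I r k"
  unfolding poisson_binomial_tail_def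
  by (intro sum_nonneg mult_nonneg_nonneg prod_nonneg) (use assms in \<open>auto simp: subset_iff\<close>)

lemma poisson_binomial_tail_antimono:
  assumes "finite I" "\<And>i. i \<in> I \<Longrightarrow> r i \<in> {0..1}" "k \<le> l"
  shows "poisson_binomial_tail I r l \<le> poisson_binomial_tail I r k"
  unfolding poisson_binomial_tail_def
proof (intro sum_mono2 mult_nonneg_nonneg prod_nonneg)
  show "finite {J \<in> Pow I. k \<le> card J}"
    using assms by simp
qed (use assms in \<open>auto simp: subset_iff\<close>)

lemma poisson_binomial_tail_le_1:
  assumes "finite I" "\<And>i. i \<in> I \<Longrightarrow> r i \<in> {0..1}"
  shows "poisson_binomial_tail I r k \<le> 1"
  using poisson_binomial_tail_antimono[of I r 0 k] poisson_binomial_tail_0[of I r] assms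
  by simp

text \<open>Induction on the trials. By the recursion, the tail is affine in the success probability
  of \<open>i\<close>, and its slope \<open>?a s - ?b s\<close> is nonnegative because tails
  decrease in the threshold.\<close>

lemma poisson_binomial_tail_mono:
  assumes "finite I" "\<And>i. i \<in> I \<Longrightarrow> 0 \<le> r i \<and> r i \<le> s i \<and> s i \<le> 1"
  shows "poisson_binomial_tail I r k \<le> poisson_binomial_tail I s k"
  using assms
proof (induction arbitrary: k rule: finite_induct)
  case (insert i I)
  let ?a = "\<lambda>r. poisson_binomial_tail I r (k - 1)" and ?b = "\<lambda>r. poisson_binomial_tail I r k"
  have ri: "0 \<le> r i" "r i \<le> s i" "s i \<le> 1"
    using insert.prems by auto
  have IH: "poisson_binomial_tail I r l \<le> poisson_binomial_tail I s l" for l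
    using insert.prems by (intro insert.IH) auto
  have "?b s \<le> ?a s"
    using insert.prems insert.hyps by (intro poisson_binomial_tail_antimono) force+
  have "r i * ?a r + (1 - r i) * ?b r \<le> r i * ?a s + (1 - r i) * ?b s"
    using ri by (intro add_mono mult_left_mono IH) auto
  also have "\<dots> = ?b s + r i * (?a s - ?b s)"
    by (simp add: algebra_simps)
  also have "\<dots> \<le> ?b s + s i * (?a s - ?b s)"
    using ri \<open>?b s \<le> ?a s\<close> by (intro add_left_mono mult_right_mono) auto
  also have "\<dots> = s i * ?a s + (1 - s i) * ?b s"
    by (simp add: algebra_simps)
  finally show ?case
    using insert.hyps by (simp add: poisson_binomial_tail_insert)
qed (simp add: poisson_binomial_tail_empty)

text \<open>A certain success lowers the remaining threshold by one. Once the threshold is 0,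
  further certain successes change nothing, in agreement with truncated subtraction.\<close>

lemma poisson_binomial_tail_ones:
  assumes "finite J" "finite I" "I \<inter> J = {}"
  shows "poisson_binomial_tail (I \<union> J) (\<lambda>i. if i \<in> J then 1 else r i) k =
    poisson_binomial_tail I r (k - card J)"
proof -
  \<comment> \<open>The induction is over \<open>J\<close>, on which the conditional expression in
    the goal depends. An arbitrary \<open>s\<close> with the same values keeps the induction
    hypothesis applicable.\<close>
  have "poisson_binomial_tail (I \<union> J) s k = poisson_binomial_tail I r (k - card J)"
    if "\<And>j. j \<in> J \<Longrightarrow> s j = 1" "\<And>i. i \<in> I \<Longrightarrow> s i = r i" for s
    using assms that
  proof (induction arbitrary: k rule: finite_induct)
    case empty
    then show ?case
      by (auto intro: poisson_binomial_tail_cong)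
  next
    case (insert j J)
    then show ?case
      by (simp add: poisson_binomial_tail_insert)
  qed
  from this[of "\<lambda>i. if i \<in> J then 1 else r i"] show ?thesis
    using assms by (simp add: disjoint_iff)
qed

text \<open>With equal probabilities, the weight of a success set depends on its size only, so the
  sets are grouped by size and counted.\<close>

lemma poisson_binomial_tail_const:
  assumes "finite I"
  shows "poisson_binomial_tail I (\<lambda>_. p) k =
    (\<Sum>i\<in>{k..card I}. real (card I choose i) * p ^ i * (1 - p) ^ (card I - i))"
proof -
  let ?S = "{J \<in> Pow I. k \<le> card J}"
  have "poisson_binomial_tail I (\<lambda>_. p) k = (\<Sum>J\<in>?S. p ^ card J * (1 - p) ^ (card I - card J))"
    unfolding poisson_binomial_tail_def using assms
    by (intro sum.cong refl) (auto simp: card_Diff_subset finite_subset)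
  also have "\<dots> = (\<Sum>i\<in>{k..card I}. \<Sum>J\<in>{J \<in> ?S. card J = i}. p ^ card J * (1 - p) ^ (card I - card J))"
    using assms by (intro sum.group[symmetric]) (auto simp: card_mono)
  also have "\<dots> = (\<Sum>i\<in>{k..card I}. real (card I choose i) * p ^ i * (1 - p) ^ (card I - i))"
  proof (intro sum.cong refl)
    fix i assume "i \<in> {k..card I}"
    then have "{J \<in> ?S. card J = i} = {J. J \<subseteq> I \<and> card J = i}"
      by auto
    then have "card {J \<in> ?S. card J = i} = card I choose i"
      using n_subsets[OF assms] by simp
    moreover have "(\<Sum>J\<in>{J \<in> ?S. card J = i}. p ^ card J * (1 - p) ^ (card I - card J)) =
        (\<Sum>J\<in>{J \<in> ?S. card J = i}. p ^ i * (1 - p) ^ (card I - i))"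
      by (intro sum.cong refl) auto
    ultimately show "(\<Sum>J\<in>{J \<in> ?S. card J = i}. p ^ card J * (1 - p) ^ (card I - card J)) =
        real (card I choose i) * p ^ i * (1 - p) ^ (card I - i)"
      by simp
  qed
  finally show ?thesis .
qed

section \<open>Binomial tails as the case of equal success probabilities\<close>

lemma binomial_tail_eq_poisson_binomial_tail:
  assumes "finite I" "0 \<le> x"
  shows "binomial_tail p (int (card I)) x = poisson_binomial_tail I (\<lambda>_. p) (nat x)"
  unfolding binomial_tail_def poisson_binomial_tail_const[OF assms(1)]
  using assms(2)
  by (intro sum.reindex_bij_witness[of _ int nat]) (auto simp: nat_diff_distrib)

lemma binomial_tail_bounds:
  assumes "p \<in> {0..1}" "0 \<le> x"
  shows "binomial_tail p n x \<in> {0..1}"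
proof (cases "n < 0")
  case True
  with assms show ?thesis
    by (simp add: binomial_tail_def)
next
  case False
  then have "binomial_tail p n x = poisson_binomial_tail {..<nat n} (\<lambda>_. p) (nat x)"
    using binomial_tail_eq_poisson_binomial_tail[of "{..<nat n}" x p] assms by simp
  then show ?thesis
    using assms by (auto intro!: poisson_binomial_tail_nonneg poisson_binomial_tail_le_1)
qed

lemma binomial_tail_mono:
  assumes "0 \<le> p" "p \<le> p'" "p' \<le> 1" "0 \<le> x"
  shows "binomial_tail p (int n) x \<le> binomial_tail p' (int n) x"
  using binomial_tail_eq_poisson_binomial_tail[of "{..<n}" x] assms
  by (auto intro!: poisson_binomial_tail_mono)

lemma binomial_tail_0: "0 < x \<Longrightarrow> binomial_tail 0 n x = 0"
  by (auto simp: binomial_tail_def intro!: sum.neutral)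

lemma binomial_tail_antimono:
  assumes "p \<in> {0..1}" "0 \<le> x" "x \<le> y"
  shows "binomial_tail p (int n) y \<le> binomial_tail p (int n) x"
  using binomial_tail_eq_poisson_binomial_tail[of "{..<n}" x p]
    binomial_tail_eq_poisson_binomial_tail[of "{..<n}" y p] assms
  by (auto intro!: poisson_binomial_tail_antimono)

text \<open>The floor is constant from \<open>y\<close> up to the next integer. This supplies a
  positive \<theta> with the same number of flips as \<theta> = 0.\<close>

lemma floor_right_continuous:
  fixes y :: real
  assumes "0 < d" "0 < b"
  obtains t where "0 < t" "t < d" "\<lfloor>y + t * b\<rfloor> = \<lfloor>y\<rfloor>"
proof -
  \<comment> \<open>\<open>e\<close> is the distance from \<open>y\<close> to the next integer;
    \<open>t\<close> is chosen so that \<open>t * b\<close> covers at most half of it.\<close>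
  define e where "e = of_int \<lfloor>y\<rfloor> + 1 - y"
  define t where "t = min (d / 2) (e / (2 * b))"
  have e: "0 < e"
    unfolding e_def by linarith
  have "t * b \<le> e / (2 * b) * b"
    unfolding t_def using assms by (intro mult_right_mono) auto
  also have "\<dots> = e / 2"
    using assms by simp
  finally have "t * b < e"
    using e by linarith
  moreover have t: "0 < t" "t < d"
    using assms e by (auto simp: t_def min_less_iff_disj)
  moreover have "0 < t * b"
    using t assms by simp
  ultimately have "\<lfloor>y + t * b\<rfloor> = \<lfloor>y\<rfloor>"
    unfolding e_def by linarith
  with t that show ?thesis
    by blast
qed

lemma threshold_nonneg: "0 \<le> a \<Longrightarrow> 0 \<le> \<lceil>a * real n\<rceil>"
  using ceiling_mono[of 0 "a * real n"] by simp

text \<open>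
  Declaring more draws certain successes only raises the tail, so the worst case for
  \<open>card J \<le> m\<close> is \<open>card J = m\<close>.
\<close>
lemma poisson_binomial_tail_le_binomial_tail:
  assumes "p \<in> {0..1}" "card {i. i < n \<and> i \<in> J} \<le> m" "m \<le> n" "0 \<le> x" "nat x + m \<le> k"
  shows "poisson_binomial_tail {..<n} (\<lambda>i. if i \<in> J then 1 else p) k \<le>
    binomial_tail p (int n - int m) x"
proof -
  let ?J = "{i. i < n \<and> i \<in> J}"
  obtain K where K: "?J \<subseteq> K" "K \<subseteq> {..<n}" "card K = m"
    using exists_subset_between[of ?J m "{..<n}"] assms by auto
  have [simp]: "finite K"
    using K finite_subset by blast
  have card: "int (card ({..<n} - K)) = int n - int m"
    using K assms by (simp add: card_Diff_subset)
  have "poisson_binomial_tail {..<n} (\<lambda>i. if i \<in> J then 1 else p) k \<le>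
      poisson_binomial_tail {..<n} (\<lambda>i. if i \<in> K then 1 else p) k"
    using assms K by (intro poisson_binomial_tail_mono) auto
  also have "\<dots> = poisson_binomial_tail ({..<n} - K \<union> K) (\<lambda>i. if i \<in> K then 1 else p) k"
    using K by (simp add: Un_absorb2)
  also have "\<dots> = poisson_binomial_tail ({..<n} - K) (\<lambda>_. p) (k - m)"
    using K by (subst poisson_binomial_tail_ones) auto
  also have "\<dots> \<le> poisson_binomial_tail ({..<n} - K) (\<lambda>_. p) (nat x)"
    using assms by (intro poisson_binomial_tail_antimono) auto
  also have "\<dots> = binomial_tail p (int n - int m) x"
    using binomial_tail_eq_poisson_binomial_tail[of "{..<n} - K" x p] assms
    unfolding card by simp
  finally show ?thesis .
qed

text \<open>The event is a disjoint union of boxes, one for each set \<open>J\<close> of at least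
  \<open>k\<close> indices, and the product measure of each box is a summand of the Poisson binomial
  tail. This applies to correct outputs among instances, to declarations among draws, and to
  accurate categories among draws.\<close>

lemma
  assumes fin: "finite I"
    and Q: "\<And>i. i \<in> I \<Longrightarrow> prob_space (Q i)"
    and E: "\<And>i. i \<in> I \<Longrightarrow> E i \<in> sets (Q i)"
  shows sets_PiM_count_ge:
      "{x \<in> space (PiM I Q). k \<le> card {i\<in>I. x i \<in> E i}} \<in> sets (PiM I Q)" (is "?A \<in> _")
    and measure_PiM_count_ge:
      "\<P>(x in PiM I Q. k \<le> card {i\<in>I. x i \<in> E i}) =
         poisson_binomial_tail I (\<lambda>i. measure (Q i) (E i)) k"
proof -
  \<comment> \<open>The locale for product measures asks for a probability space at every index, so
    \<open>Q\<close> is padded outside \<open>I\<close> with a one-point space.\<close>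
  define Q' where "Q' i = (if i \<in> I then Q i else count_space {undefined})" for i
  have Q': "prob_space (Q' i)" for i
    using Q by (auto simp: Q'_def intro!: prob_spaceI)
  interpret product_prob_space Q'
    by (intro product_prob_spaceI Q')
  interpret finite_product_prob_space Q' I
    by standard (fact fin)
  have PiM: "PiM I Q = PiM I Q'"
    by (intro PiM_cong) (auto simp: Q'_def)
  \<comment> \<open>\<open>PiE I (B J)\<close> consists of the points whose set of hits is exactly
    \<open>J\<close>.\<close>
  define B where "B J i = (if i \<in> J then E i else space (Q i) - E i)" for J i
  have B: "B J i \<in> sets (Q' i)" if "i \<in> I" for J i
    using that E by (auto simp: B_def Q'_def)
  have B_eq: "{i \<in> I. x i \<in> E i} = J" if "x \<in> PiE I (B J)" "J \<subseteq> I" for x J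
    using that by (fastforce simp: PiE_iff B_def split: if_splits)
  have A_eq: "?A = (\<Union>J\<in>{J\<in>Pow I. k \<le> card J}. PiE I (B J))"
  proof (intro equalityI subsetI)
    fix x assume x: "x \<in> ?A"
    then have "x \<in> PiE I (B {i \<in> I. x i \<in> E i})"
      by (auto simp: B_def space_PiM PiE_iff)
    with x show "x \<in> (\<Union>J\<in>{J\<in>Pow I. k \<le> card J}. PiE I (B J))"
      by (intro UN_I[of "{i \<in> I. x i \<in> E i}"]) auto
  next
    fix x assume "x \<in> (\<Union>J\<in>{J\<in>Pow I. k \<le> card J}. PiE I (B J))"
    then obtain J where J: "J \<subseteq> I" "k \<le> card J" "x \<in> PiE I (B J)"
      by auto
    have "B J i \<subseteq> space (Q i)" if "i \<in> I" for i
      using sets.sets_into_space[OF E[OF that]] by (auto simp: B_def)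
    then have "x \<in> space (PiM I Q)"
      using J by (auto simp: space_PiM PiE_iff)
    with J B_eq[OF J(3,1)] show "x \<in> ?A"
      by auto
  qed
  have sets: "PiE I (B J) \<in> sets (PiM I Q')" for J
    using B fin by (intro sets_PiM_I_finite) auto
  show "?A \<in> sets (PiM I Q)"
    unfolding A_eq unfolding PiM using fin sets by (intro sets.finite_UN) auto
  have "measure (PiM I Q) ?A = (\<Sum>J\<in>{J\<in>Pow I. k \<le> card J}. prob (PiE I (B J)))"
    unfolding A_eq unfolding PiM using fin sets
  proof (intro finite_measure_finite_Union)
    show "disjoint_family_on (\<lambda>J. PiE I (B J)) {J\<in>Pow I. k \<le> card J}"
      unfolding disjoint_family_on_def disjoint_iff
    proof (intro ballI impI allI notI)
      fix J K x assume "J \<in> {J\<in>Pow I. k \<le> card J}" "K \<in> {J\<in>Pow I. k \<le> card J}"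
        and "J \<noteq> K" "x \<in> PiE I (B J)" "x \<in> PiE I (B K)"
      then show False
        using B_eq[of x J] B_eq[of x K] by simp
    qed
  qed auto
  also have "\<dots> = poisson_binomial_tail I (\<lambda>i. measure (Q i) (E i)) k"
    unfolding poisson_binomial_tail_def
  proof (intro sum.cong refl)
    fix J assume J: "J \<in> {J\<in>Pow I. k \<le> card J}"
    have "prob (PiE I (B J)) = (\<Prod>i\<in>I. measure (Q' i) (B J i))"
      using B by (intro prob_times) auto
    also have "\<dots> = (\<Prod>i\<in>I. if i \<in> J then measure (Q i) (E i) else 1 - measure (Q i) (E i))"
      using Q E by (intro prod.cong) (auto simp: B_def Q'_def prob_space.prob_compl)
    also have "\<dots> = (\<Prod>i\<in>J. measure (Q i) (E i)) * (\<Prod>i\<in>I - J. 1 - measure (Q i) (E i))"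
      using J fin by (subst prod.If_cases) (auto simp: Int_absorb1 Diff_eq)
    finally show "prob (PiE I (B J)) =
        (\<Prod>i\<in>J. measure (Q i) (E i)) * (\<Prod>i\<in>I - J. 1 - measure (Q i) (E i))" .
  qed
  finally show "measure (PiM I Q) ?A = poisson_binomial_tail I (\<lambda>i. measure (Q i) (E i)) k" .
qed

subsection \<open>The sampling experiment\<close>

locale category_sampling =
  fixes C :: "'c set" and S :: "'x measure" and P :: "'c \<Rightarrow> 'x measure" and h :: "'x \<Rightarrow> 'c"
    and N M :: nat
  assumes finite_C: "finite C" and C_nonempty: "C \<noteq> {}"
    and prob_space_P: "\<And>c. c \<in> C \<Longrightarrow> prob_space (P c)"
    and sets_P: "\<And>c. c \<in> C \<Longrightarrow> sets (P c) = sets S"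
    and h_measurable: "h \<in> measurable S (count_space C)"
    and N_pos: "N \<ge> 1" and M_pos: "M \<ge> 1"
begin

section \<open>The two stages of the experiment and its disintegration\<close>

definition category_draws :: "(nat \<Rightarrow> 'c) measure" where
  "category_draws = (\<Pi>\<^sub>M j\<in>{..<N}. uniform_count_measure C)"

definition instance_space :: "(nat \<Rightarrow> nat \<Rightarrow> 'x) measure" where
  "instance_space = (\<Pi>\<^sub>M j\<in>{..<N}. \<Pi>\<^sub>M i\<in>{..<M}. S)"

definition instance_draws :: "(nat \<Rightarrow> 'c) \<Rightarrow> (nat \<Rightarrow> nat \<Rightarrow> 'x) measure" where
  "instance_draws c = (\<Pi>\<^sub>M j\<in>{..<N}. \<Pi>\<^sub>M i\<in>{..<M}. P (c j))"

lemma space_P: "c \<in> C \<Longrightarrow> space (P c) = space S"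
  using sets_P sets_eq_imp_space_eq by blast

text \<open>Since \<open>C\<close> is finite, the drawn category sequences form a discrete space.
  Measurability in \<open>c\<close> is therefore automatic in what follows.\<close>

lemma sets_category_draws: "sets category_draws = Pow ({..<N} \<rightarrow>\<^sub>E C)"
proof -
  have "sets category_draws = sets (\<Pi>\<^sub>M j\<in>{..<N}. count_space C)"
    unfolding category_draws_def by (intro sets_PiM_cong) (auto simp: sets_uniform_count_measure)
  then show ?thesis
    using finite_C by (simp add: count_space_PiM_finite countable_finite)
qed

lemma space_category_draws: "space category_draws = {..<N} \<rightarrow>\<^sub>E C"
  unfolding category_draws_def by (simp add: space_PiM space_uniform_count_measure)

lemma finite_space_category_draws: "finite (space category_draws)"
  unfolding space_category_draws using finite_C by (intro finite_PiE) auto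

lemma prob_space_category_draws: "prob_space category_draws"
  unfolding category_draws_def using finite_C C_nonempty
  by (intro prob_space_PiM prob_space_uniform_count_measure)

lemma category_draws_in_C: "c \<in> space category_draws \<Longrightarrow> j < N \<Longrightarrow> c j \<in> C"
  by (auto simp: space_category_draws)

lemma sets_instance_draws:
  assumes "c \<in> space category_draws"
  shows "sets (instance_draws c) = sets instance_space"
  unfolding instance_draws_def instance_space_def
  using assms by (intro sets_PiM_cong refl) (auto simp: category_draws_in_C sets_P)

lemma prob_space_instance_draws:
  assumes "c \<in> space category_draws"
  shows "prob_space (instance_draws c)"
  unfolding instance_draws_def
  using assms by (intro prob_space_PiM prob_space_P) (auto simp: category_draws_in_C)

lemma Pair_measurable_instance_draws:
  assumes "c \<in> space category_draws"
  shows "Pair c \<in> measurable (instance_draws c) (category_draws \<Otimes>\<^sub>M instance_space)"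
  unfolding measurable_cong_sets[OF sets_instance_draws[OF assms] refl]
  by (rule measurable_Pair1'[OF assms])

text \<open>Binding into a \<open>return\<close> is a pushforward, so the experiment is a mixture,
  over the drawn categories, of image measures of the instance draws.\<close>

lemma sampling_experiment_eq:
  "sampling_experiment C S P N M = category_draws \<bind>
     (\<lambda>c. distr (instance_draws c) (category_draws \<Otimes>\<^sub>M instance_space) (Pair c))"
  unfolding sampling_experiment_def category_draws_def[symmetric] instance_space_def[symmetric]
    instance_draws_def[symmetric]
  by (intro bind_cong refl bind_return_distr' Pair_measurable_instance_draws
      prob_space.not_empty prob_space_instance_draws)

lemma measurable_distr_instance_draws:
  "(\<lambda>c. distr (instance_draws c) (category_draws \<Otimes>\<^sub>M instance_space) (Pair c))
     \<in> measurable category_draws (subprob_algebra (category_draws \<Otimes>\<^sub>M instance_space))"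
proof -
  \<comment> \<open>On a discrete domain, a kernel only has to take its values in the space of
    subprobability measures.\<close>
  have "sets category_draws = sets (count_space (space category_draws))"
    by (simp add: sets_category_draws space_category_draws)
  note cong = measurable_cong_sets[OF this refl]
  have "distr (instance_draws c) (category_draws \<Otimes>\<^sub>M instance_space) (Pair c)
      \<in> space (subprob_algebra (category_draws \<Otimes>\<^sub>M instance_space))"
    if "c \<in> space category_draws" for c
    using that by (auto simp: space_subprob_algebra intro!: prob_space_imp_subprob_space
        prob_space.prob_space_distr prob_space_instance_draws Pair_measurable_instance_draws)
  then show ?thesis
    unfolding cong by simp
qed

lemma sets_sampling_experiment:
  "sets (sampling_experiment C S P N M) = sets (category_draws \<Otimes>\<^sub>M instance_space)"
  unfolding sampling_experiment_eq
  by (intro sets_bind[OF sets_kernel[OF measurable_distr_instance_draws]]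
      prob_space.not_empty prob_space_category_draws)

lemma prob_space_sampling_experiment: "prob_space (sampling_experiment C S P N M)"
  unfolding sampling_experiment_eq
  by (intro prob_space.prob_space_bind[OF prob_space_category_draws _ measurable_distr_instance_draws]
      AE_I2 prob_space.prob_space_distr prob_space_instance_draws Pair_measurable_instance_draws)

text \<open>There are finitely many sequences \<open>c\<close>, so the set is a finite union of
  measurable slices.\<close>

lemma sets_pairI:
  assumes "W \<subseteq> space (category_draws \<Otimes>\<^sub>M instance_space)"
    and "\<And>c. c \<in> space category_draws \<Longrightarrow> Pair c -` W \<in> sets instance_space"
  shows "W \<in> sets (category_draws \<Otimes>\<^sub>M instance_space)"
proof -
  have "W = (\<Union>c\<in>space category_draws. {c} \<times> Pair c -` W)"
    using assms(1) by (auto simp: space_pair_measure)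
  moreover have "(\<Union>c\<in>space category_draws. {c} \<times> Pair c -` W)
      \<in> sets (category_draws \<Otimes>\<^sub>M instance_space)"
    using assms(2) finite_space_category_draws
    by (intro sets.finite_UN pair_measureI) (auto simp: sets_category_draws space_category_draws)
  ultimately show ?thesis
    by simp
qed

text \<open>The law of total probability, conditioning on the drawn categories.\<close>

lemma emeasure_sampling_experiment:
  assumes W: "W \<in> sets (category_draws \<Otimes>\<^sub>M instance_space)"
  shows "emeasure (sampling_experiment C S P N M) W =
    (\<integral>\<^sup>+c. emeasure (instance_draws c) (Pair c -` W) \<partial>category_draws)"
proof -
  have "emeasure (sampling_experiment C S P N M) W = (\<integral>\<^sup>+c. emeasure
      (distr (instance_draws c) (category_draws \<Otimes>\<^sub>M instance_space) (Pair c)) W \<partial>category_draws)"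
    unfolding sampling_experiment_eq
    by (intro emeasure_bind[OF _ measurable_distr_instance_draws W]
        prob_space.not_empty prob_space_category_draws)
  also have "\<dots> = (\<integral>\<^sup>+c. emeasure (instance_draws c) (Pair c -` W) \<partial>category_draws)"
  proof (intro nn_integral_cong)
    fix c assume c: "c \<in> space category_draws"
    have "Pair c -` W \<subseteq> space (instance_draws c)"
      using sets.sets_into_space[OF W] sets_eq_imp_space_eq[OF sets_instance_draws[OF c]]
      by (auto simp: space_pair_measure)
    then show "emeasure (distr (instance_draws c) (category_draws \<Otimes>\<^sub>M instance_space) (Pair c)) W =
        emeasure (instance_draws c) (Pair c -` W)"
      using W c Pair_measurable_instance_draws by (simp add: emeasure_distr Int_absorb2)
  qed
  finally show ?thesis .
qed

section \<open>Declaring a single drawn category classifiable\<close>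

definition declared :: "real \<Rightarrow> 'c \<Rightarrow> (nat \<Rightarrow> 'x) set" where
  "declared a d = {x \<in> space (\<Pi>\<^sub>M i\<in>{..<M}. S). a \<le> empirical_accuracy h M d x}"

text \<open>Clearing the denominator \<open>M\<close> turns the real threshold into an integer one,
  because a count reaches a real bound iff it reaches its ceiling. The result has the shape required
  by \<open>measure_PiM_count_ge\<close>.\<close>

lemma declared_eq:
  assumes "0 \<le> a" "d \<in> C"
  shows "declared a d = {x \<in> space (\<Pi>\<^sub>M i\<in>{..<M}. P d).
    nat \<lceil>a * real M\<rceil> \<le> card {i\<in>{..<M}. x i \<in> {y \<in> space (P d). h y = d}}}"
proof -
  have space: "space (\<Pi>\<^sub>M i\<in>{..<M}. P d) = space (\<Pi>\<^sub>M i\<in>{..<M}. S)"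
    using space_P[OF assms(2)] by (simp add: space_PiM)
  have "a \<le> empirical_accuracy h M d x \<longleftrightarrow>
      nat \<lceil>a * real M\<rceil> \<le> card {i\<in>{..<M}. x i \<in> {y \<in> space (P d). h y = d}}"
    if x: "x \<in> space (\<Pi>\<^sub>M i\<in>{..<M}. S)" for x
  proof -
    have "{i\<in>{..<M}. x i \<in> {y \<in> space (P d). h y = d}} = {i. i < M \<and> h (x i) = d}"
      using x space_P[OF assms(2)] by (auto simp: space_PiM PiE_iff)
    then show ?thesis
      using M_pos assms
      by (simp add: empirical_accuracy_def pos_le_divide_eq nat_le_iff ceiling_le_iff)
  qed
  then show ?thesis
    unfolding declared_def space by auto
qed

lemma classified_sets:
  assumes "d \<in> C"
  shows "{y \<in> space (P d). h y = d} \<in> sets (P d)"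
proof -
  have "h -` {d} \<inter> space S \<in> sets S"
    using h_measurable assms by (intro measurable_sets) auto
  moreover have "h -` {d} \<inter> space S = {y \<in> space (P d). h y = d}"
    using space_P[OF assms] by auto
  ultimately show ?thesis
    using sets_P[OF assms] by simp
qed

lemma declared_sets:
  assumes "0 \<le> a" "d \<in> C"
  shows "declared a d \<in> sets (\<Pi>\<^sub>M i\<in>{..<M}. P d)"
  unfolding declared_eq[OF assms] using assms
  by (intro sets_PiM_count_ge prob_space_P classified_sets) auto

lemma measure_declared:
  assumes "0 \<le> a" "d \<in> C"
  shows "measure (\<Pi>\<^sub>M i\<in>{..<M}. P d) (declared a d) =
    binomial_tail (true_positive_accuracy P h d) (int M) \<lceil>a * real M\<rceil>"
proof -
  have "measure (\<Pi>\<^sub>M i\<in>{..<M}. P d) (declared a d) =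
      poisson_binomial_tail {..<M} (\<lambda>_. true_positive_accuracy P h d) (nat \<lceil>a * real M\<rceil>)"
    unfolding declared_eq[OF assms] true_positive_accuracy_def using assms
    by (intro measure_PiM_count_ge prob_space_P classified_sets) auto
  also have "\<dots> = binomial_tail (true_positive_accuracy P h d) (int M) \<lceil>a * real M\<rceil>"
    using binomial_tail_eq_poisson_binomial_tail[OF _ threshold_nonneg[OF assms(1)], of "{..<M}"]
    by simp
  finally show ?thesis .
qed

lemma true_positive_accuracy_bounds:
  assumes "d \<in> C"
  shows "true_positive_accuracy P h d \<in> {0..1}"
  using prob_space.prob_le_1[OF prob_space_P[OF assms]] by (simp add: true_positive_accuracy_def)

text \<open>An inaccurate category has accuracy below \<alpha>, and the binomial tail increases with
  the success probability. The bound is the same for all inaccurate categories.\<close>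

lemma measure_declared_not_accurate:
  assumes "0 \<le> a" "d \<in> C" "\<not> accurate P h \<alpha> d" "\<alpha> \<le> 1"
  shows "measure (\<Pi>\<^sub>M i\<in>{..<M}. P d) (declared a d) \<le> binomial_tail \<alpha> (int M) \<lceil>a * real M\<rceil>"
  unfolding measure_declared[OF assms(1,2)]
  using assms true_positive_accuracy_bounds[of d]
  by (intro binomial_tail_mono threshold_nonneg) (auto simp: accurate_def)

section \<open>The number of declared draws\<close>

definition many_declared :: "real \<Rightarrow> nat \<Rightarrow> ((nat \<Rightarrow> 'c) \<times> (nat \<Rightarrow> nat \<Rightarrow> 'x)) set" where
  "many_declared a k = {(c, X) \<in> space (category_draws \<Otimes>\<^sub>M instance_space).
     k \<le> card {j\<in>{..<N}. X j \<in> declared a (c j)}}"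

lemma many_declared_section:
  assumes "c \<in> space category_draws"
  shows "Pair c -` many_declared a k =
    {X \<in> space (instance_draws c). k \<le> card {j\<in>{..<N}. X j \<in> declared a (c j)}}"
  using assms sets_eq_imp_space_eq[OF sets_instance_draws[OF assms]]
  by (auto simp: many_declared_def space_pair_measure)

text \<open>Given \<open>c\<close>, the declarations are independent, but their probabilities vary
  with the category; hence a Poisson binomial tail.\<close>

lemma
  assumes "0 \<le> a" "c \<in> space category_draws"
  shows many_declared_section_sets: "Pair c -` many_declared a k \<in> sets (instance_draws c)"
    and measure_many_declared_section: "measure (instance_draws c) (Pair c -` many_declared a k) =
      poisson_binomial_tail {..<N}
        (\<lambda>j. measure (\<Pi>\<^sub>M i\<in>{..<M}. P (c j)) (declared a (c j))) k"
  unfolding many_declared_section[OF assms(2)] unfolding instance_draws_def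
  by (intro sets_PiM_count_ge measure_PiM_count_ge prob_space_PiM prob_space_P declared_sets
      category_draws_in_C assms; simp)+

lemma many_declared_sets:
  assumes "0 \<le> a"
  shows "many_declared a k \<in> sets (category_draws \<Otimes>\<^sub>M instance_space)"
proof (intro sets_pairI)
  show "Pair c -` many_declared a k \<in> sets instance_space" if "c \<in> space category_draws" for c
    using many_declared_section_sets[OF assms that] sets_instance_draws[OF that] by simp
qed (auto simp: many_declared_def)

lemma measure_many_declared_section_le:
  assumes "0 \<le> a" "\<alpha> \<in> {0..1}" "c \<in> space category_draws"
    and "card {j. j < N \<and> accurate P h \<alpha> (c j)} \<le> m" "m \<le> N" "0 \<le> x" "nat x + m \<le> k"
  shows "measure (instance_draws c) (Pair c -` many_declared a k) \<le>
    binomial_tail (binomial_tail \<alpha> (int M) \<lceil>a * real M\<rceil>) (int N - int m) x"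
proof -
  let ?p = "binomial_tail \<alpha> (int M) \<lceil>a * real M\<rceil>" and ?J = "{j. accurate P h \<alpha> (c j)}"
  have p: "?p \<in> {0..1}"
    using assms by (intro binomial_tail_bounds threshold_nonneg) auto
  have "measure (instance_draws c) (Pair c -` many_declared a k) \<le>
      poisson_binomial_tail {..<N} (\<lambda>j. if j \<in> ?J then 1 else ?p) k"
    \<comment> \<open>Accurate draws get the trivial bound 1, all others the common bound
      \<open>?p\<close>.\<close>
    unfolding measure_many_declared_section[OF assms(1,3)]
  proof (intro poisson_binomial_tail_mono)
    fix j assume "j \<in> {..<N}"
    then have j: "c j \<in> C"
      using assms category_draws_in_C by auto
    have "prob_space (\<Pi>\<^sub>M i\<in>{..<M}. P (c j))"
      using j by (intro prob_space_PiM prob_space_P)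
    then show "0 \<le> measure (\<Pi>\<^sub>M i\<in>{..<M}. P (c j)) (declared a (c j)) \<and>
        measure (\<Pi>\<^sub>M i\<in>{..<M}. P (c j)) (declared a (c j)) \<le> (if j \<in> ?J then 1 else ?p) \<and>
        (if j \<in> ?J then 1 else ?p) \<le> 1"
      using p measure_declared_not_accurate[OF assms(1) j, of \<alpha>] assms(2)
      by (auto intro: prob_space.prob_le_1)
  qed simp
  also have "\<dots> \<le> binomial_tail ?p (int N - int m) x"
    using assms by (intro poisson_binomial_tail_le_binomial_tail p) auto
  finally show ?thesis .
qed

text \<open>Uniform draws with replacement are accurate independently of each other, each with
  probability equal to the accurate fraction.\<close>

lemma prob_accurate_draws_ge:
  "measure category_draws
     {c \<in> space category_draws. k \<le> card {j\<in>{..<N}. c j \<in> {d \<in> C. accurate P h \<alpha> d}}} =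
   binomial_tail (accurate_fraction C P h \<alpha>) (int N) (int k)"
proof -
  have "measure (uniform_count_measure C) {d \<in> C. accurate P h \<alpha> d} = accurate_fraction C P h \<alpha>"
    using finite_C by (simp add: accurate_fraction_def measure_uniform_count_measure)
  then show ?thesis
    unfolding category_draws_def
    using finite_C C_nonempty binomial_tail_eq_poisson_binomial_tail[of "{..<N}" "int k"]
    by (subst measure_PiM_count_ge)
       (auto simp: prob_space_uniform_count_measure sets_uniform_count_measure)
qed

lemma accurate_fraction_bounds: "accurate_fraction C P h \<alpha> \<in> {0..1}"
  using finite_C C_nonempty
  by (auto simp: accurate_fraction_def divide_le_eq_1 card_gt_0_iff intro!: card_mono)

lemma measure_many_declared_le:
  assumes "0 \<le> a" "\<alpha> \<in> {0..1}" "m \<le> N" "0 \<le> x" "nat x + m \<le> k"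
  shows "measure (sampling_experiment C S P N M) (many_declared a k) \<le>
    binomial_tail (binomial_tail \<alpha> (int M) \<lceil>a * real M\<rceil>) (int N - int m) x +
    binomial_tail (accurate_fraction C P h \<alpha>) (int N) (int (m + 1))"
    (is "_ \<le> ?B + ?T")
proof -
  interpret U: prob_space category_draws
    by (rule prob_space_category_draws)
  interpret E: prob_space "sampling_experiment C S P N M"
    by (rule prob_space_sampling_experiment)
  let ?A = "{c \<in> space category_draws.
    m + 1 \<le> card {j\<in>{..<N}. c j \<in> {d \<in> C. accurate P h \<alpha> d}}}"
  have A: "?A \<in> sets category_draws"
    by (auto simp: sets_category_draws space_category_draws)
  have p: "binomial_tail \<alpha> (int M) \<lceil>a * real M\<rceil> \<in> {0..1}"
    using assms by (intro binomial_tail_bounds threshold_nonneg) auto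
  have B: "0 \<le> ?B"
    using binomial_tail_bounds[OF p] assms by simp
  have T: "0 \<le> ?T"
    using binomial_tail_bounds[OF accurate_fraction_bounds] by simp
  have "emeasure (sampling_experiment C S P N M) (many_declared a k) =
      (\<integral>\<^sup>+c. emeasure (instance_draws c) (Pair c -` many_declared a k) \<partial>category_draws)"
    using assms by (intro emeasure_sampling_experiment many_declared_sets)
  \<comment> \<open>On \<open>?A\<close>, where more than \<open>m\<close> draws are accurate, the
    conditional probability is bounded by 1; elsewhere it is bounded by \<open>?B\<close>.
    Integrating the indicator produces the second tail.\<close>
  also have "\<dots> \<le> (\<integral>\<^sup>+c. ennreal ?B + indicator ?A c \<partial>category_draws)"
  proof (intro nn_integral_mono)
    fix c assume c: "c \<in> space category_draws"
    interpret K: prob_space "instance_draws c"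
      by (rule prob_space_instance_draws[OF c])
    show "emeasure (instance_draws c) (Pair c -` many_declared a k) \<le> ennreal ?B + indicator ?A c"
    proof (cases "c \<in> ?A")
      case True
      have "emeasure (instance_draws c) (Pair c -` many_declared a k) \<le> 0 + 1"
        using K.emeasure_le_1 by simp
      also have "\<dots> \<le> ennreal ?B + indicator ?A c"
        using True by (intro add_mono) auto
      finally show ?thesis .
    next
      case False
      have "{j\<in>{..<N}. c j \<in> {d \<in> C. accurate P h \<alpha> d}} = {j. j < N \<and> accurate P h \<alpha> (c j)}"
        using category_draws_in_C[OF c] by auto
      then have "card {j. j < N \<and> accurate P h \<alpha> (c j)} \<le> m"
        using False c by auto
      then have "measure (instance_draws c) (Pair c -` many_declared a k) \<le> ?B"
        using assms c by (intro measure_many_declared_section_le)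
      then have "emeasure (instance_draws c) (Pair c -` many_declared a k) \<le> ennreal ?B"
        unfolding K.emeasure_eq_measure by (rule ennreal_leI)
      then show ?thesis
        using False by simp
    qed
  qed
  also have "\<dots> = ennreal ?B + emeasure category_draws ?A"
  proof -
    have "(\<integral>\<^sup>+c. ennreal ?B + indicator ?A c \<partial>category_draws) =
        (\<integral>\<^sup>+c. ennreal ?B \<partial>category_draws) + (\<integral>\<^sup>+c. indicator ?A c \<partial>category_draws)"
      using A by (intro nn_integral_add borel_measurable_const borel_measurable_indicator)
    also have "(\<integral>\<^sup>+c. ennreal ?B \<partial>category_draws) = ennreal ?B"
      by (simp only: nn_integral_const U.emeasure_space_1 mult_1_right)
    also have "(\<integral>\<^sup>+c. indicator ?A c \<partial>category_draws) = emeasure category_draws ?A"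
      using A by (rule nn_integral_indicator)
    finally show ?thesis .
  qed
  also have "\<dots> = ennreal (?B + ?T)"
    unfolding U.emeasure_eq_measure prob_accurate_draws_ge by (rule ennreal_plus[OF B T, symmetric])
  finally show ?thesis
    using add_nonneg_nonneg[OF B T] unfolding E.emeasure_eq_measure by (simp only: ennreal_le_iff)
qed

section \<open>Bounds for the confidence in terms of the true accurate fraction\<close>

lemma confidence_eq:
  assumes "0 \<le> \<alpha> + \<epsilon>\<^sub>1" "0 \<le> \<epsilon>\<^sub>2"
  shows "confidence C S P h \<alpha> N M \<epsilon>\<^sub>1 \<epsilon>\<^sub>2 = 1 - measure (sampling_experiment C S P N M)
    (many_declared (\<alpha> + \<epsilon>\<^sub>1) (nat (\<lfloor>(accurate_fraction C P h \<alpha> + \<epsilon>\<^sub>2) * real N\<rfloor> + 1)))"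
    (is "_ = 1 - measure ?E (many_declared _ (nat (\<lfloor>?r\<rfloor> + 1)))")
proof -
  interpret E: prob_space ?E
    by (rule prob_space_sampling_experiment)
  have space: "space ?E = space (category_draws \<Otimes>\<^sub>M instance_space)"
    using sets_eq_imp_space_eq[OF sets_sampling_experiment] .
  have "accurate_fraction C P h \<alpha> \<ge> declared_fraction h \<alpha> N M \<epsilon>\<^sub>1 c X - \<epsilon>\<^sub>2 \<longleftrightarrow>
      (c, X) \<notin> many_declared (\<alpha> + \<epsilon>\<^sub>1) (nat (\<lfloor>?r\<rfloor> + 1))"
    if "(c, X) \<in> space ?E" for c X
  proof -
    let ?D = "card {j. j < N \<and> empirical_accuracy h M (c j) (X j) \<ge> \<alpha> + \<epsilon>\<^sub>1}"
    have D: "{j\<in>{..<N}. X j \<in> declared (\<alpha> + \<epsilon>\<^sub>1) (c j)} =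
        {j. j < N \<and> empirical_accuracy h M (c j) (X j) \<ge> \<alpha> + \<epsilon>\<^sub>1}"
      using that by (auto simp: space space_pair_measure instance_space_def declared_def
          space_PiM[of "{..<N}"] PiE_iff)
    \<comment> \<open>The claim fails iff the integer count exceeds the real number
      \<open>?r\<close>, that is, iff it is at least
      \<open>\<lfloor>?r\<rfloor> + 1\<close>.\<close>
    have "(c, X) \<notin> many_declared (\<alpha> + \<epsilon>\<^sub>1) (nat (\<lfloor>?r\<rfloor> + 1)) \<longleftrightarrow> int ?D \<le> \<lfloor>?r\<rfloor>"
      using that unfolding many_declared_def mem_Collect_eq case_prod_conv D space
      by (auto simp: nat_le_iff not_le)
    also have "\<dots> \<longleftrightarrow> real ?D \<le> ?r"
      by (simp add: le_floor_iff)
    also have "\<dots> \<longleftrightarrow> real ?D / real N - \<epsilon>\<^sub>2 \<le> accurate_fraction C P h \<alpha>"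
      using N_pos by (simp add: diff_le_eq pos_divide_le_eq)
    finally show ?thesis
      by (simp add: declared_fraction_def)
  qed
  then have "{(c, X) \<in> space ?E.
        accurate_fraction C P h \<alpha> \<ge> declared_fraction h \<alpha> N M \<epsilon>\<^sub>1 c X - \<epsilon>\<^sub>2} =
      space ?E - many_declared (\<alpha> + \<epsilon>\<^sub>1) (nat (\<lfloor>?r\<rfloor> + 1))"
    by auto
  moreover have "many_declared (\<alpha> + \<epsilon>\<^sub>1) (nat (\<lfloor>?r\<rfloor> + 1)) \<in> sets ?E"
    unfolding sets_sampling_experiment using assms by (intro many_declared_sets) auto
  ultimately show ?thesis
    unfolding confidence_def by (simp add: E.prob_compl case_prod_beta' conj_commute)
qed

text \<open>The split at \<open>m = \<lfloor>?y\<rfloor>\<close> accurate draws. The second tail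
  starts at \<open>m + 1\<close>, which is larger than the ceiling of \<open>?y\<close> when
  \<open>?y\<close> is an integer. It is always positive, so that this tail vanishes for
  \<open>q = 0\<close>.\<close>

lemma confidence_ge:
  assumes "0 \<le> \<alpha>" "\<alpha> \<le> 1" "0 \<le> \<epsilon>\<^sub>1" "0 \<le> \<epsilon>\<^sub>2"
    and q: "accurate_fraction C P h \<alpha> = q" and "(q + \<epsilon>\<^sub>2) * real N < real N"
  shows "confidence C S P h \<alpha> N M \<epsilon>\<^sub>1 \<epsilon>\<^sub>2 \<ge>
    1 - binomial_tail (binomial_tail \<alpha> (int M) \<lceil>(\<alpha> + \<epsilon>\<^sub>1) * real M\<rceil>)
          (int N - \<lfloor>(q + \<epsilon>\<^sub>2 / 2) * real N\<rfloor>) \<lceil>\<epsilon>\<^sub>2 / 2 * real N\<rceil>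
      - binomial_tail q (int N) (\<lfloor>(q + \<epsilon>\<^sub>2 / 2) * real N\<rfloor> + 1)"
proof -
  let ?y = "(q + \<epsilon>\<^sub>2 / 2) * real N" and ?r = "(q + \<epsilon>\<^sub>2) * real N"
  let ?x = "\<lceil>\<epsilon>\<^sub>2 / 2 * real N\<rceil>"
  define m where "m = nat \<lfloor>?y\<rfloor>"
  have q_nonneg: "0 \<le> q"
    using accurate_fraction_bounds[of \<alpha>] q by simp
  have x: "0 \<le> ?x"
    using assms by (intro threshold_nonneg) simp
  have "0 \<le> ?y"
    using q_nonneg assms by simp
  then have m: "int m = \<lfloor>?y\<rfloor>"
    by (simp add: m_def)
  have r: "?r = ?y + \<epsilon>\<^sub>2 / 2 * real N"
    by (simp add: algebra_simps)
  have "0 \<le> \<epsilon>\<^sub>2 / 2 * real N"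
    using assms by simp
  then have "?y < real N"
    using r assms by linarith
  then have "m \<le> N"
    using m by linarith
  \<comment> \<open>The sum of the ceiling and the floor is an integer below \<open>?r + 1\<close>.
    The strict excess needed for failure thus absorbs the rounding up in \<open>?x\<close>.\<close>
  moreover have "?x + int m \<le> \<lfloor>?r\<rfloor> + 1"
    unfolding m r by linarith
  then have "nat ?x + m \<le> nat (\<lfloor>?r\<rfloor> + 1)"
    using x by linarith
  ultimately have "measure (sampling_experiment C S P N M)
      (many_declared (\<alpha> + \<epsilon>\<^sub>1) (nat (\<lfloor>?r\<rfloor> + 1))) \<le>
    binomial_tail (binomial_tail \<alpha> (int M) \<lceil>(\<alpha> + \<epsilon>\<^sub>1) * real M\<rceil>) (int N - int m) ?x +
    binomial_tail (accurate_fraction C P h \<alpha>) (int N) (int (m + 1))"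
    using assms x unfolding q[symmetric] by (intro measure_many_declared_le) auto
  moreover have "int (m + 1) = \<lfloor>?y\<rfloor> + 1"
    by (simp add: m)
  ultimately show ?thesis
    using assms by (simp add: confidence_eq q m add.commute)
qed

text \<open>Failure of the claim would take more than \<open>N\<close> declared draws.\<close>

lemma confidence_eq_1:
  assumes "0 \<le> \<alpha> + \<epsilon>\<^sub>1" "0 \<le> \<epsilon>\<^sub>2"
    and "real N \<le> (accurate_fraction C P h \<alpha> + \<epsilon>\<^sub>2) * real N"
  shows "confidence C S P h \<alpha> N M \<epsilon>\<^sub>1 \<epsilon>\<^sub>2 = 1"
proof -
  let ?k = "nat (\<lfloor>(accurate_fraction C P h \<alpha> + \<epsilon>\<^sub>2) * real N\<rfloor> + 1)"
  have "N < ?k"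
    using assms by linarith
  moreover have "card {j\<in>{..<N}. X j \<in> declared a (c j)} \<le> N" for X a c
    using card_mono[of "{..<N}" "{j\<in>{..<N}. X j \<in> declared a (c j)}"] by auto
  ultimately have "many_declared (\<alpha> + \<epsilon>\<^sub>1) ?k = {}"
    unfolding many_declared_def by (auto simp: not_le intro: le_less_trans)
  then show ?thesis
    using assms by (simp add: confidence_eq)
qed

end

section \<open>Comparison with the infimum over \<theta>\<close>

theorem theorem1:
  fixes C :: "'c set" and S :: "'x measure" and P :: "'c \<Rightarrow> 'x measure" and h :: "'x \<Rightarrow> 'c"
    and \<alpha> \<epsilon>\<^sub>1 \<epsilon>\<^sub>2 :: real and N M :: nat
  assumes "finite C" and "C \<noteq> {}"
    and "\<And>c. c \<in> C \<Longrightarrow> prob_space (P c)"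
    and "\<And>c. c \<in> C \<Longrightarrow> sets (P c) = sets S"
    and "h \<in> measurable S (count_space C)"
    and "0 \<le> \<alpha>" and "\<alpha> \<le> 1" and "\<epsilon>\<^sub>1 \<ge> 0" and "\<epsilon>\<^sub>2 \<ge> 0"
    and "N \<ge> 1" and "M \<ge> 1"
  shows "confidence C S P h \<alpha> N M \<epsilon>\<^sub>1 \<epsilon>\<^sub>2 \<ge>
    (INF \<theta>\<in>{0<..<1}.
       1 - binomial_tail
             (binomial_tail \<alpha> (int M) \<lceil>(\<alpha> + \<epsilon>\<^sub>1) * real M\<rceil>)
             (int N - \<lfloor>(\<theta> + \<epsilon>\<^sub>2 / 2) * real N\<rfloor>)
             \<lceil>\<epsilon>\<^sub>2 / 2 * real N\<rceil>
         - binomial_tail \<theta> (int N) \<lceil>(\<theta> + \<epsilon>\<^sub>2 / 2) * real N\<rceil>)"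
proof -
  interpret category_sampling C S P h N M
    by (rule category_sampling.intro) (fact assms)+
  define q where "q = accurate_fraction C P h \<alpha>"
  define p where "p = binomial_tail \<alpha> (int M) \<lceil>(\<alpha> + \<epsilon>\<^sub>1) * real M\<rceil>"
  define x where "x = \<lceil>\<epsilon>\<^sub>2 / 2 * real N\<rceil>"
  define y where "y \<theta> = (\<theta> + \<epsilon>\<^sub>2 / 2) * real N" for \<theta>
  define f where
    "f \<theta> = 1 - binomial_tail p (int N - \<lfloor>y \<theta>\<rfloor>) x - binomial_tail \<theta> (int N) \<lceil>y \<theta>\<rceil>" for \<theta>
  have q: "0 \<le> q" "q \<le> 1"
    using accurate_fraction_bounds[of \<alpha>] by (auto simp: q_def)
  have x: "0 \<le> x"
    unfolding x_def using assms by (intro threshold_nonneg) simp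
  have y: "0 \<le> \<lceil>y \<theta>\<rceil>" if "0 \<le> \<theta>" for \<theta>
    unfolding y_def using that assms by (intro threshold_nonneg) simp
  have "p \<in> {0..1}"
    unfolding p_def using assms by (intro binomial_tail_bounds threshold_nonneg) auto
  then have tail1: "binomial_tail p n x \<in> {0..1}" for n
    using x by (intro binomial_tail_bounds)
  have tail2: "binomial_tail \<theta> (int N) \<lceil>y \<theta>\<rceil> \<in> {0..1}" if "\<theta> \<in> {0<..<1}" for \<theta>
    using that by (intro binomial_tail_bounds y) auto
  \<comment> \<open>A real infimum is a lower bound only for sets bounded below; both tails lie
    between 0 and 1, so -1 serves.\<close>
  have "bdd_below (f ` {0<..<1})"
  proof (rule bdd_belowI2)
    fix \<theta> :: real assume "\<theta> \<in> {0<..<1}"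
    then show "-1 \<le> f \<theta>"
      using tail1[of "int N - \<lfloor>y \<theta>\<rfloor>"] tail2[of \<theta>] by (simp add: f_def)
  qed
  then have INF_le: "(INF \<theta>\<in>{0<..<1}. f \<theta>) \<le> f \<theta>" if "\<theta> \<in> {0<..<1}" for \<theta>
    using that by (rule cINF_lower)
  have "(INF \<theta>\<in>{0<..<1}. f \<theta>) \<le> confidence C S P h \<alpha> N M \<epsilon>\<^sub>1 \<epsilon>\<^sub>2"
  proof (cases "(q + \<epsilon>\<^sub>2) * real N < real N")
    case False
    \<comment> \<open>The value 1/2 is arbitrary: every \<open>f \<theta>\<close> in the range is at
      most 1.\<close>
    have "(INF \<theta>\<in>{0<..<1}. f \<theta>) \<le> f (1 / 2)"
      by (rule INF_le) simp
    also have "\<dots> \<le> 1"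
      using tail1[of "int N - \<lfloor>y (1 / 2)\<rfloor>"] tail2[of "1 / 2"] by (simp add: f_def)
    also have "\<dots> = confidence C S P h \<alpha> N M \<epsilon>\<^sub>1 \<epsilon>\<^sub>2"
      using False assms by (subst confidence_eq_1) (auto simp: q_def)
    finally show ?thesis .
  next
    case True
    have conf: "1 - binomial_tail p (int N - \<lfloor>y q\<rfloor>) x - binomial_tail q (int N) (\<lfloor>y q\<rfloor> + 1) \<le>
        confidence C S P h \<alpha> N M \<epsilon>\<^sub>1 \<epsilon>\<^sub>2"
      unfolding p_def x_def y_def using assms True q_def by (intro confidence_ge) auto
    show ?thesis
    proof (cases "q = 0")
      case False
      have "q + \<epsilon>\<^sub>2 < 1"
        using True assms by simp
      then have "(INF \<theta>\<in>{0<..<1}. f \<theta>) \<le> f q"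
        using False q assms by (intro INF_le) auto
      \<comment> \<open>Passing from the floor plus one to the ceiling can only lower the threshold,
        which enlarges the subtracted tail.\<close>
      also have "binomial_tail q (int N) (\<lfloor>y q\<rfloor> + 1) \<le> binomial_tail q (int N) \<lceil>y q\<rceil>"
        using q y[of q] by (intro binomial_tail_antimono) (auto, linarith)
      then have "f q \<le> confidence C S P h \<alpha> N M \<epsilon>\<^sub>1 \<epsilon>\<^sub>2"
        using conf by (simp add: f_def)
      finally show ?thesis .
    next
      \<comment> \<open>\<open>\<theta> = 0\<close> is excluded from the infimum, but a small \<open>\<theta> > 0\<close> gives the same number of flips.\<close>
      case True
      obtain \<theta> where \<theta>: "0 < \<theta>" "\<theta> < 1" "\<lfloor>y 0 + \<theta> * real N\<rfloor> = \<lfloor>y 0\<rfloor>"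
        using floor_right_continuous[of 1 "real N" "y 0"] assms by auto
      have floor: "\<lfloor>y \<theta>\<rfloor> = \<lfloor>y 0\<rfloor>"
        using \<theta>(3) by (simp add: y_def algebra_simps)
      have "0 \<le> y 0"
        using assms by (simp add: y_def)
      \<comment> \<open>The threshold is at least 1, and with success probability 0 there are no
        successes.\<close>
      then have "binomial_tail q (int N) (\<lfloor>y q\<rfloor> + 1) = 0"
        unfolding True by (intro binomial_tail_0) linarith
      have "(INF \<theta>\<in>{0<..<1}. f \<theta>) \<le> f \<theta>"
        using \<theta> by (intro INF_le) auto
      also have "\<dots> \<le> 1 - binomial_tail p (int N - \<lfloor>y q\<rfloor>) x"
        using tail2[of \<theta>] \<theta> floor True by (simp add: f_def)
      also have "\<dots> \<le> confidence C S P h \<alpha> N M \<epsilon>\<^sub>1 \<epsilon>\<^sub>2"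
        using conf \<open>binomial_tail q (int N) (\<lfloor>y q\<rfloor> + 1) = 0\<close> by simp
      finally show ?thesis .
    qed
  qed
  then show ?thesis
    by (simp only: f_def p_def x_def y_def)
qed

end
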